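(* Let $d,\Delta\ge 1$ and let $G$ be a simple graph with maximum degree $\Delta$. Then: (a) $\chi'_d(G)=\lceil \Delta/d\rceil$ if $d$ does not divide $\Delta$, or $d$ is even, or $\Delta=d$; (b) if $d$ is odd and $\Delta=2d$, then $\chi'_d(G)=2$ if and only if every $2d$-regular connected component of $G$ has an even number of vertices, and otherwise $\chi'_d(G)=3$.
   Context: An edge colouring of $G$ with defect $d$ is a colouring of its edges such that each vertex is incident with at most $d$ edges of each colour. $\chi'_d(G)$ is the minimum number of colours in an edge colouring of $G$ with defect $d$. *)

theory Defs
  imports Complex_Main
begin

text \<open>Finite simple undirected graphs: a vertex set \<open>V\<close> and an edge set \<open>E\<close> of
  two-element subsets of \<open>V\<close>.\<close>

definition simple_graph :: "'a set \<Rightarrow> 'a set set \<Rightarrow> bool" where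
  "simple_graph V E \<longleftrightarrow> finite V \<and> (\<forall>e\<in>E. e \<subseteq> V \<and> card e = 2)"

definition vertex_degree :: "'a set set \<Rightarrow> 'a \<Rightarrow> nat" where
  "vertex_degree E v = card {e \<in> E. v \<in> e}"

text \<open>The inserted \<open>0\<close> only matters for the graph without vertices, where \<open>Max\<close> would be
  unspecified.\<close>

definition max_degree :: "'a set \<Rightarrow> 'a set set \<Rightarrow> nat" where
  "max_degree V E = Max (insert 0 (vertex_degree E ` V))"

definition regular_graph :: "nat \<Rightarrow> 'a set \<Rightarrow> 'a set set \<Rightarrow> bool" where
  "regular_graph r V E \<longleftrightarrow> (\<forall>v\<in>V. vertex_degree E v = r)"

definition graph_component_of :: "'a set set \<Rightarrow> 'a \<Rightarrow> 'a set" where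
  "graph_component_of E v = {u. (v, u) \<in> {(x, y). {x, y} \<in> E}\<^sup>*}"

text \<open>A connected component is represented by its vertex set; as a graph it is the subgraph
  induced on that set.\<close>

definition graph_components :: "'a set \<Rightarrow> 'a set set \<Rightarrow> 'a set set" where
  "graph_components V E = graph_component_of E ` V"

definition induced_edges :: "'a set set \<Rightarrow> 'a set \<Rightarrow> 'a set set" where
  "induced_edges E C = {e \<in> E. e \<subseteq> C}"

text \<open>No properness is required: edges of the same colour may share a vertex, up to the defect.\<close>

definition defect_edge_colouring ::
    "nat \<Rightarrow> 'a set \<Rightarrow> 'a set set \<Rightarrow> ('a set \<Rightarrow> 'c) \<Rightarrow> bool" where
  "defect_edge_colouring d V E c \<longleftrightarrow>
     (\<forall>v\<in>V. \<forall>i. card {e \<in> E. v \<in> e \<and> c e = i} \<le> d)"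

definition defect_chromatic_index :: "nat \<Rightarrow> 'a set \<Rightarrow> 'a set set \<Rightarrow> nat" where
  "defect_chromatic_index d V E =
     (LEAST k. \<exists>c :: 'a set \<Rightarrow> nat. c ` E \<subseteq> {..<k} \<and> defect_edge_colouring d V E c)"

text \<open>For \<open>d \<ge> 1\<close> the minimum is taken over a nonempty set: all edges can get distinct colours.\<close>

lemma defect_edge_colouring_exists:
  assumes "simple_graph V E" and "d \<ge> 1"
  shows "\<exists>k. \<exists>c :: 'a set \<Rightarrow> nat. c ` E \<subseteq> {..<k} \<and> defect_edge_colouring d (V :: 'a set) E c"
proof -
  have "finite E"
    using assms(1) finite_subset[of E "Pow V"] by (auto simp: simple_graph_def)
  then obtain c :: "'a set \<Rightarrow> nat" and k where c: "c ` E = {i. i < k}" "inj_on c E"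
    using finite_imp_nat_seg_image_inj_on[of E] finite_imp_inj_to_nat_seg[of E] by blast
  have "card {e \<in> E. v \<in> e \<and> c e = i} \<le> 1" for v i
    using c(2) by (subst card_le_Suc0_iff_eq[folded One_nat_def])
      (auto simp: \<open>finite E\<close> dest: inj_onD)
  then have "defect_edge_colouring d V E c"
    using assms(2) order_trans unfolding defect_edge_colouring_def by blast
  with c(1) show ?thesis by (auto simp: lessThan_def)
qed

end

theory Submission
  imports Defs "HOL-Combinatorics.Transposition"
begin

text \<open>A graph is split into two parts that are as balanced as possible at every vertex. The only
  obstruction is a component in which all degrees are even and the number of edges is odd, and there
  the imbalance can be moved to any chosen vertex. This settles \<open>\<Delta> = 2 * d\<close>. For even \<open>d\<close> a
  \<open>2 * d\<close>-regular component has an even number of edges and is no obstruction; take a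
  colouring with \<open>k\<close> colours and minimal total excess over \<open>d\<close>: if \<open>\<Delta> \<le> k * d\<close> and some vertex
  has more than \<open>d\<close> edges of one colour, it has fewer than \<open>d\<close> of another, and splitting the union of these two
  colour classes anew lowers the excess. If \<open>d\<close> does not divide \<open>\<Delta>\<close>, then \<open>\<Delta> + 1 \<le> k * d\<close> for
  \<open>k = \<lceil>\<Delta> / d\<rceil>\<close>, and Vizing's theorem yields a proper colouring with \<open>k * d\<close> colours, which are merged
  in groups of \<open>d\<close>.\<close>

section \<open>Components and degrees\<close>

lemma graph_component_of_refl: "v \<in> graph_component_of F v"
  by (simp add: graph_component_of_def)

lemma graph_component_of_eq:
  assumes "u \<in> graph_component_of F v"
  shows "graph_component_of F u = graph_component_of F v"
proof -
  let ?r = "{(x, y). {x, y} \<in> F}"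
  have "sym ?r" by (auto simp: sym_def insert_commute)
  then have "sym (?r\<^sup>*)" by (rule sym_rtrancl)
  moreover have "(v, u) \<in> ?r\<^sup>*" using assms by (simp add: graph_component_of_def)
  ultimately have "(v, w) \<in> ?r\<^sup>* \<longleftrightarrow> (u, w) \<in> ?r\<^sup>*" for w
    using rtrancl_trans[of v u ?r w] rtrancl_trans[of u v ?r w] symD[of "?r\<^sup>*" v u] by blast
  then show ?thesis by (simp add: graph_component_of_def)
qed

lemma graph_component_of_sym:
  "u \<in> graph_component_of F v \<Longrightarrow> v \<in> graph_component_of F u"
  using graph_component_of_eq graph_component_of_refl by metis

lemma graph_component_of_step:
  assumes "u \<in> graph_component_of F v" "{u, w} \<in> F"
  shows "w \<in> graph_component_of F v"
  using assms rtrancl_into_rtrancl[of v u "{(x, y). {x, y} \<in> F}" w]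
  by (simp add: graph_component_of_def)

lemma graph_component_of_edge:
  assumes "card e = 2" "e \<in> F" "u \<in> e" "u \<in> graph_component_of F v"
  shows "e \<subseteq> graph_component_of F v"
proof -
  obtain a b where "e = {a, b}" using assms(1) by (auto simp: card_2_iff)
  then show ?thesis
    using assms graph_component_of_step[of _ F v] by (auto simp: insert_commute)
qed

lemma graph_component_of_subset: "graph_component_of F v \<subseteq> insert v (\<Union>F)"
proof
  fix u assume "u \<in> graph_component_of F v"
  then have "(v, u) \<in> {(x, y). {x, y} \<in> F}\<^sup>*" by (simp add: graph_component_of_def)
  then show "u \<in> insert v (\<Union>F)" by (cases rule: rtranclE) auto
qed

lemma finite_Union_edges:
  assumes "finite F" "\<And>e. e \<in> F \<Longrightarrow> card e = 2"
  shows "finite (\<Union>F)"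
proof (rule finite_Union[OF assms(1)])
  show "finite e" if "e \<in> F" for e using assms(2)[OF that] card.infinite by fastforce
qed

lemma finite_graph_component_of:
  assumes "finite F" "\<And>e. e \<in> F \<Longrightarrow> card e = 2"
  shows "finite (graph_component_of F v)"
  using finite_subset[OF graph_component_of_subset[of F v]] finite_Union_edges[OF assms] by simp

text \<open>Follow a walk from \<open>v\<close> to \<open>z\<close> up to its first use of the
  deleted edge: the end of the edge at which the walk arrives is reached without that edge.\<close>

lemma graph_component_of_delete:
  assumes "z \<in> graph_component_of F v"
  shows "z \<in> graph_component_of (F - {{w, u}}) v \<or> w \<in> graph_component_of (F - {{w, u}}) v \<or>
    u \<in> graph_component_of (F - {{w, u}}) v"
proof -
  have "(v, z) \<in> {(x, y). {x, y} \<in> F}\<^sup>*" using assms by (simp add: graph_component_of_def)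
  then show ?thesis
  proof (induction rule: rtrancl_induct)
    case base
    then show ?case by (simp add: graph_component_of_refl)
  next
    case (step y z)
    show ?case
    proof (cases "{y, z} = {w, u}")
      case True
      then show ?thesis using step.IH by (auto simp: doubleton_eq_iff)
    next
      case False
      then have "{y, z} \<in> F - {{w, u}}" using step by auto
      then show ?thesis using step.IH graph_component_of_step by metis
    qed
  qed
qed

lemma graph_component_of_boundary:
  assumes "v \<in> S" "z \<in> graph_component_of F v" "z \<notin> S"
  obtains p q where "p \<in> S" "q \<notin> S" "q \<in> graph_component_of F v" "{p, q} \<in> F"
proof -
  have "(v, z) \<in> {(x, y). {x, y} \<in> F}\<^sup>*" using assms by (simp add: graph_component_of_def)
  then have "z \<in> S \<or> (\<exists>p q. p \<in> S \<and> q \<notin> S \<and> q \<in> graph_component_of F v \<and> {p, q} \<in> F)"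
  proof (induction rule: rtrancl_induct)
    case base
    then show ?case using assms(1) by simp
  next
    case (step y z)
    then have "z \<in> graph_component_of F v"
      using rtrancl_into_rtrancl[OF step.hyps] by (simp add: graph_component_of_def)
    with step show ?case by auto
  qed
  with assms(3) that show thesis by blast
qed

text \<open>In place of a spanning tree, a set \<open>S\<close> is grown from \<open>{v}\<close> one
  vertex at a time. Each added vertex \<open>q\<close> brings an edge crossing the boundary of
  \<open>S\<close>, and this edge was not inside \<open>S\<close> before.\<close>

lemma card_component_le:
  assumes F: "finite F" "\<And>e. e \<in> F \<Longrightarrow> card e = 2"
  shows "card (graph_component_of F v) \<le> card {e \<in> F. e \<subseteq> graph_component_of F v} + 1"
proof -
  let ?C = "graph_component_of F v"
  have fC: "finite ?C" by (rule finite_graph_component_of[OF F])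
  have grow: "\<exists>S\<subseteq>?C. v \<in> S \<and> card S = Suc n \<and> n \<le> card {e \<in> F. e \<subseteq> S}"
    if "n < card ?C" for n
    using that
  proof (induction n)
    case 0
    then show ?case
      by (intro exI[of _ "{v}"]) (auto simp: graph_component_of_refl)
  next
    case (Suc n)
    then obtain S where S: "S \<subseteq> ?C" "v \<in> S" "card S = Suc n" "n \<le> card {e \<in> F. e \<subseteq> S}" by auto
    then obtain z where "z \<in> ?C" "z \<notin> S" using Suc.prems by (metis nat_less_le subsetI subset_antisym)
    then obtain p q where pq: "p \<in> S" "q \<notin> S" "q \<in> ?C" "{p, q} \<in> F"
      using graph_component_of_boundary[OF S(2)] by metis
    have "finite S" using S(1) fC finite_subset by blast
    have "insert {p, q} {e \<in> F. e \<subseteq> S} \<subseteq> {e \<in> F. e \<subseteq> insert q S}" using pq by auto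
    then have "card (insert {p, q} {e \<in> F. e \<subseteq> S}) \<le> card {e \<in> F. e \<subseteq> insert q S}"
      by (intro card_mono) (use F in auto)
    moreover have "card (insert {p, q} {e \<in> F. e \<subseteq> S}) = Suc (card {e \<in> F. e \<subseteq> S})"
      using pq F by (subst card_insert_disjoint) auto
    ultimately have "Suc n \<le> card {e \<in> F. e \<subseteq> insert q S}" using S(4) by linarith
    then show ?case
      using S pq \<open>finite S\<close> by (intro exI[of _ "insert q S"]) auto
  qed
  show ?thesis
  proof (cases "card ?C")
    case (Suc n)
    then obtain S where S: "S \<subseteq> ?C" "card S = Suc n" "n \<le> card {e \<in> F. e \<subseteq> S}"
      using grow[of n] by auto
    then have "S = ?C" using Suc fC by (simp add: card_subset_eq)
    then show ?thesis using S Suc by simp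
  qed simp
qed

section \<open>Handshake counting inside components\<close>

lemma sum_vertex_degree:
  assumes "finite F" "\<And>e. e \<in> F \<Longrightarrow> card e = 2" "finite C" "\<And>e. e \<in> F \<Longrightarrow> e \<subseteq> C"
  shows "(\<Sum>v\<in>C. vertex_degree F v) = 2 * card F"
proof -
  have "{v \<in> C. v \<in> e} = e" if "e \<in> F" for e using assms(4) that by blast
  then have "(\<Sum>v\<in>C. card {e \<in> F. v \<in> e}) = (\<Sum>e\<in>F. 2)"
    using assms by (intro sum_multicount_gen) auto
  then show ?thesis by (simp add: vertex_degree_def)
qed

lemma vertex_degree_induced_component:
  assumes "\<And>e. e \<in> F \<Longrightarrow> card e = 2" "G \<subseteq> F" "u \<in> graph_component_of F v"
  shows "vertex_degree (induced_edges G (graph_component_of F v)) u = vertex_degree G u"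
proof -
  have "{e \<in> induced_edges G (graph_component_of F v). u \<in> e} = {e \<in> G. u \<in> e}"
    using assms graph_component_of_edge[of _ F u v] by (fastforce simp: induced_edges_def)
  then show ?thesis by (simp add: vertex_degree_def)
qed

text \<open>The handshake lemma for the edges of \<open>G\<close> inside the component. Components
  are taken in \<open>F\<close>, because \<open>G\<close> will be one part of a splitting or one
  colour class of the whole graph.\<close>

lemma even_sum_component_degree:
  assumes "finite F" "\<And>e. e \<in> F \<Longrightarrow> card e = 2" "G \<subseteq> F"
  shows "even (\<Sum>u\<in>graph_component_of F v. vertex_degree G u)"
proof -
  let ?C = "graph_component_of F v"
  have "(\<Sum>u\<in>?C. vertex_degree G u) = (\<Sum>u\<in>?C. vertex_degree (induced_edges G ?C) u)"
    by (rule sum.cong) (simp_all add: vertex_degree_induced_component[OF assms(2,3)])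
  also have "\<dots> = 2 * card (induced_edges G ?C)"
    using assms finite_subset[OF assms(3)] finite_graph_component_of[OF assms(1,2)]
    by (intro sum_vertex_degree) (auto simp: induced_edges_def)
  finally show ?thesis by simp
qed

lemma vertex_degree_split:
  assumes "finite F" "A \<subseteq> F"
  shows "vertex_degree F v = vertex_degree A v + vertex_degree (F - A) v"
proof -
  have "{e \<in> F. v \<in> e} = {e \<in> A. v \<in> e} \<union> {e \<in> F - A. v \<in> e}" using assms(2) by blast
  moreover have "finite {e \<in> A. v \<in> e}" "finite {e \<in> F - A. v \<in> e}"
    using assms(1) finite_subset[OF assms(2,1)] by simp_all
  moreover have "{e \<in> A. v \<in> e} \<inter> {e \<in> F - A. v \<in> e} = {}" by blast
  ultimately show ?thesis unfolding vertex_degree_def by (metis card_Un_disjoint)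
qed

section \<open>Balanced signings\<close>

text \<open>A signing with values 1 and -1 stands for a splitting of \<open>F\<close> into two
  parts, and this is the difference of the degrees of \<open>v\<close> in them.\<close>

definition discrepancy :: "'a set set \<Rightarrow> ('a set \<Rightarrow> int) \<Rightarrow> 'a \<Rightarrow> int" where
  "discrepancy F x v = (\<Sum>e | e \<in> F \<and> v \<in> e. x e)"

lemma even_discrepancy:
  assumes "finite F" "\<And>e. x e \<in> {1, -1}"
  shows "even (discrepancy F x v) \<longleftrightarrow> even (vertex_degree F v)"
proof -
  have "odd (x e)" for e using assms(2)[of e] by auto
  then have "{a \<in> {e \<in> F. v \<in> e}. odd (x a)} = {e \<in> F. v \<in> e}" by auto
  then show ?thesis
    using assms(1) by (simp add: discrepancy_def vertex_degree_def even_sum_iff)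
qed

lemma discrepancy_insert:
  assumes "finite F" "e \<notin> F"
  shows "discrepancy (insert e F) (x(e := t)) v = discrepancy F x v + (if v \<in> e then t else 0)"
proof -
  have "{f \<in> insert e F. v \<in> f} = (if v \<in> e then insert e {f \<in> F. v \<in> f} else {f \<in> F. v \<in> f})"
    by auto
  moreover have "(\<Sum>f | f \<in> F \<and> v \<in> f. (x(e := t)) f) = (\<Sum>f | f \<in> F \<and> v \<in> f. x f)"
    using assms by (intro sum.cong) auto
  ultimately show ?thesis using assms by (simp add: discrepancy_def)
qed

lemma vertex_degree_insert:
  assumes "finite F" "e \<notin> F"
  shows "vertex_degree (insert e F) v = vertex_degree F v + (if v \<in> e then 1 else 0)"
proof -
  have "{f \<in> insert e F. v \<in> f} = (if v \<in> e then insert e {f \<in> F. v \<in> f} else {f \<in> F. v \<in> f})"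
    by auto
  then show ?thesis using assms by (simp add: vertex_degree_def)
qed

text \<open>Vertices of odd degree never need to be listed in \<open>R\<close>, as their discrepancy is odd.
  A root of a component can absorb the defect of an Euler tour of odd length; deleting an edge
  at a root or at an odd vertex replaces the construction of the tour.\<close>

lemma balanced_signing:
  assumes "finite F" "\<And>e. e \<in> F \<Longrightarrow> card e = 2"
    and "\<And>v. v \<in> \<Union>F \<Longrightarrow> \<exists>w\<in>graph_component_of F v. w \<in> R \<or> odd (vertex_degree F w)"
  shows "\<exists>x. (\<forall>e. x e \<in> {1, -1}) \<and> (\<forall>v. \<bar>discrepancy F x v\<bar> \<le> (if v \<in> R then 2 else 1))"
  using assms
proof (induction "card F" arbitrary: F R)
  case 0
  then show ?case by (intro exI[of _ "\<lambda>_. 1"]) (auto simp: discrepancy_def)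
next
  case (Suc n)
  obtain e0 where "e0 \<in> F" using Suc.hyps(2) by fastforce
  then obtain v0 where v0: "v0 \<in> e0" using Suc.prems(2) by fastforce
  then obtain w where w: "w \<in> graph_component_of F v0" "w \<in> R \<or> odd (vertex_degree F w)"
    using Suc.prems(3) \<open>e0 \<in> F\<close> by blast
  have "w \<in> \<Union>F" using graph_component_of_subset[of F v0] w v0 \<open>e0 \<in> F\<close> by blast
  then obtain e where "e \<in> F" "w \<in> e" by blast
  then obtain u where e: "e = {w, u}" "w \<noteq> u" using Suc.prems(2)[of e] by (auto simp: card_2_iff)
  define F' where "F' = F - {{w, u}}"
  have F: "F = insert {w, u} F'" "{w, u} \<notin> F'" "finite F'" and n: "n = card F'"
    using \<open>e \<in> F\<close> e Suc.prems(1) Suc.hyps(2) by (auto simp: F'_def)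
  have card2: "\<And>e. e \<in> F' \<Longrightarrow> card e = 2" using Suc.prems(2) by (simp add: F'_def)
  have deg: "vertex_degree F v = vertex_degree F' v + (if v \<in> {w, u} then 1 else 0)" for v
    unfolding F(1) by (rule vertex_degree_insert[OF F(3,2)])
  \<comment> \<open>Without the edge, a component contains one of its ends or keeps a vertex of the
    required kind whose degree has not changed.\<close>
  have hit: "w \<in> graph_component_of F' v \<or> u \<in> graph_component_of F' v \<or>
    (\<exists>z\<in>graph_component_of F' v. z \<notin> {w, u} \<and> (z \<in> R \<or> odd (vertex_degree F' z)))"
    if "v \<in> \<Union>F'" for v
  proof -
    obtain z where "z \<in> graph_component_of F v" "z \<in> R \<or> odd (vertex_degree F z)"
      using Suc.prems(3)[of v] \<open>v \<in> \<Union>F'\<close> F(1) by auto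
    then show ?thesis
      using graph_component_of_delete[of z F v w u] deg[of z] unfolding F'_def[symmetric]
      by (cases "z \<in> {w, u}") auto
  qed
  \<comment> \<open>Restoring the edge with sign \<open>t\<close> changes the discrepancy only at
    \<open>w\<close> and \<open>u\<close>, so only these two ends have to be checked in the cases
    below.\<close>
  have extend: ?case if x: "\<forall>e. x e \<in> {1, -1}" and R': "R' \<subseteq> R \<union> {w, u}"
    and disc: "\<forall>v. \<bar>discrepancy F' x v\<bar> \<le> (if v \<in> R' then 2 else 1)"
    and t: "t \<in> {1, -1}" "\<bar>discrepancy F' x w + t\<bar> \<le> (if w \<in> R then 2 else 1)"
      "\<bar>discrepancy F' x u + t\<bar> \<le> (if u \<in> R then 2 else 1)" for x R' t
  proof (intro exI[of _ "x({w, u} := t)"] conjI allI)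
    show "(x({w, u} := t)) e \<in> {1, -1}" for e using x t(1) by simp
    fix v
    have "discrepancy F (x({w, u} := t)) v = discrepancy F' x v + (if v \<in> {w, u} then t else 0)"
      unfolding F(1) by (rule discrepancy_insert[OF F(3,2)])
    then show "\<bar>discrepancy F (x({w, u} := t)) v\<bar> \<le> (if v \<in> R then 2 else 1)"
      using t(2,3) disc[rule_format, of v] R' by (auto split: if_splits)
  qed
  show ?case
  proof (cases "u \<in> graph_component_of F' w")
    \<comment> \<open>The deleted edge is a bridge. Both ends may serve as roots of the remaining
      graph, and negating all signs on the side of \<open>u\<close> reverses the discrepancy at
      \<open>u\<close> without touching \<open>w\<close>, so one \<open>t\<close> can suit both
      ends.\<close>
    case False
    let ?B = "graph_component_of F' u"
    have "w \<notin> ?B" using False graph_component_of_sym by metis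
    have "\<exists>z\<in>graph_component_of F' v. z \<in> R \<union> {w, u} \<or> odd (vertex_degree F' z)"
      if "v \<in> \<Union>F'" for v using hit[OF that] by blast
    from Suc.hyps(1)[OF n F(3) card2 this] obtain x where x: "\<forall>e. x e \<in> {1, -1}"
      "\<forall>v. \<bar>discrepancy F' x v\<bar> \<le> (if v \<in> R \<union> {w, u} then 2 else 1)" by blast
    define y where "y e = (if e \<subseteq> ?B then - x e else x e)" for e
    have y: "discrepancy F' y v = (if v \<in> ?B then - discrepancy F' x v else discrepancy F' x v)" for v
    proof (cases "v \<in> ?B")
      case True
      then have "e \<subseteq> ?B" if "e \<in> F'" "v \<in> e" for e
        using graph_component_of_edge[OF card2] that by metis
      then have "discrepancy F' y v = (\<Sum>e | e \<in> F' \<and> v \<in> e. - x e)"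
        unfolding discrepancy_def by (intro sum.cong) (auto simp: y_def)
      then show ?thesis using True by (simp add: discrepancy_def sum_negf)
    next
      case False
      then show ?thesis
        unfolding discrepancy_def by (auto simp: y_def intro!: sum.cong)
    qed
    have "u \<in> ?B" by (rule graph_component_of_refl)
    define t :: int where "t = (if discrepancy F' x w > 0 then -1 else 1)"
    have t: "t \<in> {1, -1}" "\<bar>discrepancy F' x w + t\<bar> \<le> 1"
      using x(2)[rule_format, of w] by (auto simp: t_def)
    have "\<bar>discrepancy F' x u + t\<bar> \<le> 1 \<or> \<bar>- discrepancy F' x u + t\<bar> \<le> 1"
      using x(2)[rule_format, of u] t(1) by auto
    then show ?thesis
    proof
      assume "\<bar>discrepancy F' x u + t\<bar> \<le> 1"
      then show ?thesis using t by (intro extend[OF x(1) _ x(2), of t]) auto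
    next
      assume "\<bar>- discrepancy F' x u + t\<bar> \<le> 1"
      have abs: "\<bar>discrepancy F' y v\<bar> = \<bar>discrepancy F' x v\<bar>" for v by (simp add: y)
      have "\<bar>discrepancy F' y u + t\<bar> \<le> 1" using \<open>\<bar>- discrepancy F' x u + t\<bar> \<le> 1\<close> y \<open>u \<in> ?B\<close> by simp
      moreover have "\<forall>e. y e \<in> {1, -1}" using x(1) by (auto simp: y_def)
      moreover have "\<forall>v. \<bar>discrepancy F' y v\<bar> \<le> (if v \<in> R \<union> {w, u} then 2 else 1)"
        using x(2) unfolding abs .
      moreover have "\<bar>discrepancy F' y w + t\<bar> \<le> 1" using t y \<open>w \<notin> ?B\<close> by simp
      ultimately show ?thesis using t by (intro extend[of y "R \<union> {w, u}" t]) auto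
    qed
  next
    case True
    have nb: "w \<in> graph_component_of F' v \<longleftrightarrow> u \<in> graph_component_of F' v" for v
      using graph_component_of_eq graph_component_of_sym True by metis
    define R' where "R' =
      (if odd (vertex_degree F w) \<and> odd (vertex_degree F u) then R \<union> {w} - {u} else R - {w})"
    have "\<exists>z\<in>graph_component_of F' v. z \<in> R' \<or> odd (vertex_degree F' z)" if v: "v \<in> \<Union>F'" for v
    proof -
      consider "w \<in> graph_component_of F' v" "u \<in> graph_component_of F' v"
        | z where "z\<in>graph_component_of F' v" "z \<notin> {w, u}" "z \<in> R \<or> odd (vertex_degree F' z)"
        using hit[OF v] nb[of v] by metis
      then show ?thesis
      proof cases
        case 1
        have "w \<in> R' \<or> odd (vertex_degree F' w) \<or> odd (vertex_degree F' u)"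
          using deg[of w] deg[of u] e(2) by (simp add: R'_def)
        with 1 show ?thesis by blast
      next
        case 2
        then show ?thesis by (intro bexI[of _ z]) (auto simp: R'_def)
      qed
    qed
    from Suc.hyps(1)[OF n F(3) card2 this] obtain x where x: "\<forall>e. x e \<in> {1, -1}"
      "\<forall>v. \<bar>discrepancy F' x v\<bar> \<le> (if v \<in> R' then 2 else 1)" by blast
    have ev: "even (discrepancy F' x v) \<longleftrightarrow> even (vertex_degree F' v)" for v
      using even_discrepancy[OF F(3)] x(1) by metis
    \<comment> \<open>At \<open>z\<close> the discrepancy may be 2 in absolute value, and
      \<open>t\<close> is chosen against it. The other end has discrepancy 0, or it is
      \<open>w\<close> as a member of \<open>R\<close>, where an absolute value of at most 1 may
      grow to 2.\<close>
    define z where "z = (if odd (vertex_degree F w) \<and> odd (vertex_degree F u) then w else u)"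
    define t :: int where "t = (if discrepancy F' x z > 0 then -1 else 1)"
    have small: "discrepancy F' x v = 0" if "even (vertex_degree F' v)" "v \<notin> R'" for v
      using ev[of v] x(2)[rule_format, of v] that by (auto elim!: evenE)
    have "t \<in> {1, -1}" by (simp add: t_def)
    have z: "\<bar>discrepancy F' x z + t\<bar> \<le> 1"
      using x(2)[rule_format, of z] by (auto simp: t_def split: if_splits)
    have "\<bar>discrepancy F' x w + t\<bar> \<le> (if w \<in> R then 2 else 1) \<and>
      \<bar>discrepancy F' x u + t\<bar> \<le> (if u \<in> R then 2 else 1)"
    proof (cases "odd (vertex_degree F w)")
      case odd_w: True
      show ?thesis
      proof (cases "odd (vertex_degree F u)")
        case True
        then have "even (vertex_degree F' u)" using deg[of u] by simp
        moreover have "z = w" "u \<notin> R'" using odd_w True by (simp_all add: z_def R'_def)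
        ultimately have "z = w" "discrepancy F' x u = 0" using small by blast+
        then show ?thesis using z \<open>t \<in> _\<close> by auto
      next
        case False
        then have "z = u" "even (vertex_degree F' w)" "w \<notin> R'"
          using odd_w deg[of w] by (simp_all add: z_def R'_def)
        then have "z = u" "discrepancy F' x w = 0" using small by blast+
        then show ?thesis using z \<open>t \<in> _\<close> by auto
      qed
    next
      case False
      then have "w \<in> R" "z = u" "w \<notin> R'" using w by (auto simp: z_def R'_def)
      moreover have "\<bar>discrepancy F' x w\<bar> \<le> 1" using x(2)[rule_format, of w] \<open>w \<notin> R'\<close> by simp
      ultimately show ?thesis using z \<open>t \<in> _\<close> by auto
    qed
    then show ?thesis
      using \<open>t \<in> _\<close> by (intro extend[OF x(1) _ x(2), of t]) (auto simp: R'_def)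
  qed
qed

text \<open>For \<open>vertex_degree F v \<le> 2 * d\<close> the bounds say that neither part exceeds \<open>d\<close> at \<open>v\<close>; otherwise
  they say that both parts have at least \<open>d\<close> edges at \<open>v\<close>, so in all cases the total excess over
  \<open>d\<close> at \<open>v\<close> is as small as possible.\<close>

lemma split_edges:
  assumes F: "finite F" "\<And>e. e \<in> F \<Longrightarrow> card e = 2"
    and reg: "\<And>v. (\<forall>u\<in>graph_component_of F v. vertex_degree F u = 2 * d) \<Longrightarrow>
      even (d * card (graph_component_of F v))"
  shows "\<exists>A\<subseteq>F. \<forall>v. vertex_degree A v \<le> max d (vertex_degree F v - d) \<and>
    vertex_degree (F - A) v \<le> max d (vertex_degree F v - d)"
proof -
  \<comment> \<open>\<open>root\<close> depends on the component only, so each component has a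
    single root. A discrepancy of 2 occurs only at even degrees and is harmless unless the degree is
    \<open>2 * d\<close>, because other even degrees differ from \<open>2 * d\<close> by at least 2.
    Hence a \<open>2 * d\<close>-regular component contributes just its root to
    \<open>R\<close>.\<close>
  define root where "root v = (SOME w. w \<in> graph_component_of F v)" for v
  define R where "R = {v. vertex_degree F v \<noteq> 2 * d} \<union>
    root ` {v. \<forall>w\<in>graph_component_of F v. vertex_degree F w = 2 * d}"
  have root: "root v \<in> graph_component_of F v" for v
    unfolding root_def by (rule someI[of _ v]) (rule graph_component_of_refl)
  have "\<exists>w\<in>graph_component_of F v. w \<in> R \<or> odd (vertex_degree F w)" for v
    using root[of v] by (auto simp: R_def)
  with balanced_signing[OF F, of R] obtain x where x: "\<And>e. x e \<in> {1, -1}"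
    "\<And>v. \<bar>discrepancy F x v\<bar> \<le> (if v \<in> R then 2 else 1)" by metis
  define A where "A = {e \<in> F. x e = 1}"
  have AF: "A \<subseteq> F" by (auto simp: A_def)
  note deg = vertex_degree_split[OF F(1) AF]
  have disc: "discrepancy F x v = int (vertex_degree A v) - int (vertex_degree (F - A) v)" for v
  proof -
    have "{e \<in> F. v \<in> e} = {e \<in> A. v \<in> e} \<union> {e \<in> F - A. v \<in> e}" using AF by blast
    then have "discrepancy F x v = sum x {e \<in> A. v \<in> e} + sum x {e \<in> F - A. v \<in> e}"
      unfolding discrepancy_def using F(1) AF finite_subset[OF AF F(1)]
      by (simp only:) (rule sum.union_disjoint, auto)
    also have "sum x {e \<in> A. v \<in> e} = (\<Sum>e | e \<in> A \<and> v \<in> e. 1)"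
      by (rule sum.cong) (auto simp: A_def)
    also have "sum x {e \<in> F - A. v \<in> e} = (\<Sum>e | e \<in> F - A \<and> v \<in> e. -1)"
      by (rule sum.cong) (use x(1) in \<open>auto simp: A_def\<close>)
    finally show ?thesis by (simp add: vertex_degree_def)
  qed
  have bound: "vertex_degree A v \<le> max d (vertex_degree F v - d) \<and>
    vertex_degree (F - A) v \<le> max d (vertex_degree F v - d)" for v
  proof (cases "vertex_degree F v = 2 * d")
    case False
    then show ?thesis using disc[of v] deg[of v] x(2)[of v] by (auto split: if_splits)
  next
    case v: True
    have small: "vertex_degree A u = d" if "vertex_degree F u = 2 * d" "u \<notin> R" for u
      using disc[of u] deg[of u] x(2)[of u] that by auto
    have "vertex_degree A v = d"
    proof (cases "v \<in> R")
      case False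
      then show ?thesis using small v by simp
    next
      case True
      then obtain u where u: "v = root u"
        "\<forall>w\<in>graph_component_of F u. vertex_degree F w = 2 * d" using v by (auto simp: R_def)
      let ?C = "graph_component_of F v"
      have C: "graph_component_of F u = ?C" using root[of u] graph_component_of_eq u(1) by metis
      have uniq: "w = v" if "w \<in> ?C" "w \<in> range root" for w
      proof -
        obtain t where t: "w = root t" using \<open>w \<in> range root\<close> by blast
        then have "graph_component_of F t = graph_component_of F w"
          using root[of t] graph_component_of_eq by metis
        also have "\<dots> = graph_component_of F u" using \<open>w \<in> ?C\<close> C graph_component_of_eq by metis
        finally show "w = v" using t u(1) by (simp add: root_def)
      qed
      have all: "\<forall>w\<in>?C. vertex_degree F w = 2 * d" using u(2) C by simp
      have fC: "finite ?C" by (rule finite_graph_component_of[OF F])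
      \<comment> \<open>In this component \<open>A\<close> takes exactly \<open>d\<close> edges at
        every vertex other than the root \<open>v\<close>. Handshake parity and \<open>reg\<close>
        then give \<open>vertex_degree A v\<close> the parity of \<open>d\<close>, and a discrepancy
        of at most 2 leaves only the value \<open>d\<close>.\<close>
      have "vertex_degree A w = d" if "w \<in> ?C - {v}" for w
        using small[of w] all uniq[of w] that by (auto simp: R_def)
      then have "(\<Sum>w\<in>?C. vertex_degree A w) = vertex_degree A v + (card ?C - 1) * d"
        using fC graph_component_of_refl[of v F] by (simp add: sum.remove[of ?C v])
      moreover have "even (\<Sum>w\<in>?C. vertex_degree A w)"
        by (rule even_sum_component_degree[OF F]) (auto simp: A_def)
      ultimately have "even (vertex_degree A v + (card ?C - 1) * d)" by simp
      moreover have "even (d * card ?C)" using reg all by blast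
      moreover obtain m where "card ?C = Suc m"
        using fC graph_component_of_refl[of v F] by (metis card_Suc_Diff1)
      ultimately have par: "even (vertex_degree A v) \<longleftrightarrow> even d" by simp argo
      have "\<bar>int (vertex_degree A v) - int (vertex_degree (F - A) v)\<bar> \<le> 2"
        using disc[of v] x(2)[of v] by (simp split: if_splits)
      moreover have "vertex_degree A v + vertex_degree (F - A) v = 2 * d" using deg[of v] v by simp
      ultimately show ?thesis using par by presburger
    qed
    then show ?thesis using v deg[of v] by simp
  qed
  show ?thesis by (rule exI[of _ A]) (use bound AF in blast)
qed

section \<open>Even defect\<close>

lemma sum_vertex_degree_colours:
  fixes k :: nat
  assumes "finite E" "c ` E \<subseteq> {..<k}"
  shows "(\<Sum>i<k. vertex_degree {e \<in> E. c e = i} v) = vertex_degree E v"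
proof -
  have "(\<Sum>i<k. \<Sum>e | e \<in> {e \<in> E. v \<in> e} \<and> c e = i. 1) = (\<Sum>e | e \<in> E \<and> v \<in> e. 1 :: nat)"
    using assms by (intro sum.group) auto
  then show ?thesis by (simp add: vertex_degree_def conj_commute conj_left_commute)
qed

lemma even_defect_colouring:
  assumes E: "finite E" "\<And>e. e \<in> E \<Longrightarrow> card e = 2" and "even d"
    and deg: "\<And>v. vertex_degree E v \<le> k * d"
  shows "\<exists>c. c ` E \<subseteq> {..<k} \<and> (\<forall>v i. vertex_degree {e \<in> E. c e = i} v \<le> d)"
proof -
  define col where "col c i = {e \<in> E. c e = i}" for c :: "'a set \<Rightarrow> nat" and i
  \<comment> \<open>The subtraction is truncated, so only edges beyond \<open>d\<close>
    count.\<close>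
  define excess where "excess c v = (\<Sum>i<k. vertex_degree (col c i) v - d)" for c v
  have "\<exists>c :: 'a set \<Rightarrow> nat. c ` E \<subseteq> {..<k}"
  proof (cases "E = {}")
    case False
    then obtain e v where "e \<in> E" "v \<in> e" using E(2) by fastforce
    then have "vertex_degree E v > 0" using E(1) by (auto simp: vertex_degree_def card_gt_0_iff)
    then have "k > 0" using deg[of v] by (cases k) auto
    then show ?thesis by (intro exI[of _ "\<lambda>_. 0"]) auto
  qed simp
  then obtain c0 :: "'a set \<Rightarrow> nat" where "c0 ` E \<subseteq> {..<k}" ..
  from ex_has_least_nat[of "\<lambda>c. c ` E \<subseteq> {..<k}", OF this, of "\<lambda>c. \<Sum>v\<in>\<Union>E. excess c v"]
  obtain c :: "'a set \<Rightarrow> nat" where c: "c ` E \<subseteq> {..<k}"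
    and least: "\<And>c'. c' ` E \<subseteq> {..<k} \<Longrightarrow> (\<Sum>v\<in>\<Union>E. excess c v) \<le> (\<Sum>v\<in>\<Union>E. excess c' v)"
    by metis
  have "vertex_degree (col c i) v \<le> d" for v i
  proof (rule ccontr)
    assume v: "\<not> vertex_degree (col c i) v \<le> d"
    then have "vertex_degree (col c i) v > 0" by simp
    then obtain e where "e \<in> col c i" "v \<in> e"
      unfolding vertex_degree_def card_gt_0_iff by blast
    then have "i < k" "v \<in> \<Union>E" using c by (auto simp: col_def)
    \<comment> \<open>Pigeonhole: the \<open>k\<close> colours share at most \<open>k * d\<close>
      edges at \<open>v\<close>, so an overfull colour leaves another one below
      \<open>d\<close>.\<close>
    obtain j where j: "j < k" "vertex_degree (col c j) v < d"
    proof (rule ccontr)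
      assume "\<not> thesis"
      then have "\<forall>j<k. d \<le> vertex_degree (col c j) v" using that by (meson not_le)
      then have "(\<Sum>j<k. d) < (\<Sum>j<k. vertex_degree (col c j) v)"
        using v \<open>i < k\<close> by (intro sum_strict_mono_ex1) (auto simp: not_le)
      then have "k * d < (\<Sum>j<k. vertex_degree (col c j) v)" by simp
      then show False
        using deg[of v] sum_vertex_degree_colours[OF E(1) c, of v] by (simp add: col_def)
    qed
    \<comment> \<open>Here \<open>p\<close>, \<open>q\<close> are the old and \<open>a\<close>,
      \<open>b\<close> the new degrees of a vertex in two colours. The bounds force the new excess
      down to its minimum, the truncated \<open>p + q - 2 * d\<close>; the old excess is larger when
      \<open>p > d\<close> and \<open>q < d\<close>.\<close>
    have excess_le: "(a - d) + (b - d) \<le> (p - d) + (q - d) \<and>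
        (p > d \<longrightarrow> q < d \<longrightarrow> (a - d) + (b - d) < (p - d) + (q - d))"
      if "a + b = p + q" "a \<le> max d (p + q - d)" "b \<le> max d (p + q - d)" for a b p q :: nat
    proof (cases "p + q \<le> 2 * d")
      case True
      then show ?thesis using that by (simp add: max_def split: if_splits)
    next
      case False
      then have "a \<ge> d" "b \<ge> d" using that by linarith+
      then show ?thesis using False that by linarith
    qed
    have "i \<noteq> j" using v j by auto
    define H where "H = col c i \<union> col c j"
    have H: "finite H" "\<And>e. e \<in> H \<Longrightarrow> card e = 2" using E by (auto simp: H_def col_def)
    \<comment> \<open>For even \<open>d\<close> the parity hypothesis of \<open>split_edges\<close>
      holds outright, so the union of any two classes can be split.\<close>
    obtain A where A: "A \<subseteq> H" "\<And>v. vertex_degree A v \<le> max d (vertex_degree H v - d)"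
      "\<And>v. vertex_degree (H - A) v \<le> max d (vertex_degree H v - d)"
      using split_edges[OF H, of d] \<open>even d\<close> by auto
    define c' where "c' e = (if e \<in> H then if e \<in> A then i else j else c e)" for e
    have col': "col c' i = A" "col c' j = H - A"
      "\<And>l. l \<noteq> i \<Longrightarrow> l \<noteq> j \<Longrightarrow> col c' l = col c l"
      using A(1) \<open>i \<noteq> j\<close> by (auto simp: col_def c'_def H_def)
    have split: "excess b u = (vertex_degree (col b i) u - d) + (vertex_degree (col b j) u - d) +
        (\<Sum>l\<in>{..<k} - {i} - {j}. vertex_degree (col b l) u - d)" for b u
      using \<open>i < k\<close> \<open>j < k\<close> \<open>i \<noteq> j\<close>
      by (simp add: excess_def sum.remove[of "{..<k}" i] sum.remove[of "{..<k} - {i}" j])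
    have rest: "(\<Sum>l\<in>{..<k} - {i} - {j}. vertex_degree (col c' l) u - d) =
        (\<Sum>l\<in>{..<k} - {i} - {j}. vertex_degree (col c l) u - d)" for u
      by (intro sum.cong) (auto simp: col')
    have "H - col c i = col c j" using \<open>i \<noteq> j\<close> by (auto simp: H_def col_def)
    then have degs: "vertex_degree H u = vertex_degree (col c i) u + vertex_degree (col c j) u"
      "vertex_degree H u = vertex_degree A u + vertex_degree (H - A) u" for u
      using vertex_degree_split[OF H(1), of "col c i" u] vertex_degree_split[OF H(1) A(1), of u]
      by (simp_all add: H_def)
    note le = excess_le[OF degs(2)[unfolded degs(1), symmetric] A(2,3)[unfolded degs(1)]]
    have "excess c' u \<le> excess c u" for u
      unfolding split[of c] split[of c'] rest col' using le[of u] by simp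
    moreover have "excess c' v < excess c v"
      unfolding split[of c] split[of c'] rest col'
      by (rule add_strict_right_mono) (use le[of v] v j(2) in \<open>simp only: not_le simp_thms\<close>)
    ultimately have "(\<Sum>v\<in>\<Union>E. excess c' v) < (\<Sum>v\<in>\<Union>E. excess c v)"
      using \<open>v \<in> \<Union>E\<close> finite_Union_edges[OF E] by (intro sum_strict_mono_ex1) blast+
    moreover have "c' ` E \<subseteq> {..<k}" using c \<open>i < k\<close> \<open>j < k\<close> by (auto simp: c'_def)
    ultimately show False using least[of c'] by simp
  qed
  with c show ?thesis unfolding col_def by blast
qed

section \<open>Vizing's theorem\<close>

definition proper_edge_colouring :: "'a set set \<Rightarrow> ('a set \<Rightarrow> nat) \<Rightarrow> bool" where
  "proper_edge_colouring F c \<longleftrightarrow> (\<forall>e\<in>F. \<forall>f\<in>F. e \<noteq> f \<longrightarrow> e \<inter> f \<noteq> {} \<longrightarrow> c e \<noteq> c f)"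

definition missing :: "'a set set \<Rightarrow> ('a set \<Rightarrow> nat) \<Rightarrow> nat \<Rightarrow> 'a \<Rightarrow> bool" where
  "missing F c a v \<longleftrightarrow> (\<forall>e\<in>F. v \<in> e \<longrightarrow> c e \<noteq> a)"

lemma proper_edge_colouringD:
  "proper_edge_colouring F c \<Longrightarrow> e \<in> F \<Longrightarrow> f \<in> F \<Longrightarrow> v \<in> e \<Longrightarrow> v \<in> f \<Longrightarrow> c e = c f \<Longrightarrow> e = f"
  unfolding proper_edge_colouring_def by blast

lemma exists_missing_colour:
  assumes "finite F" "vertex_degree F v < n"
  shows "\<exists>a<n. missing F c a v"
proof -
  have "card (c ` {e \<in> F. v \<in> e}) < card {..<n}"
    using assms card_image_le[of "{e \<in> F. v \<in> e}" c] by (simp add: vertex_degree_def)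
  moreover have "finite (c ` {e \<in> F. v \<in> e})" using assms(1) by simp
  ultimately have "\<not> {..<n} \<subseteq> c ` {e \<in> F. v \<in> e}" using card_mono leD by blast
  then show ?thesis by (auto simp: missing_def)
qed

text \<open>A component with all degrees at most 2 is a path or a cycle. The proof counts: three
  vertices of degree at most 1 bound the degree sum by \<open>2 * card ?C - 3\<close>, but
  connectedness requires at least \<open>2 * (card ?C - 1)\<close>.\<close>

lemma no_three_leaves:
  assumes H: "finite H" "\<And>e. e \<in> H \<Longrightarrow> card e = 2"
    and deg: "\<And>v. vertex_degree H v \<le> 2"
    and pqr: "{p, q, r} \<subseteq> graph_component_of H v" "card {p, q, r} = 3"
    and leaf: "\<And>u. u \<in> {p, q, r} \<Longrightarrow> vertex_degree H u \<le> 1"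
  shows False
proof -
  let ?C = "graph_component_of H v"
  have fC: "finite ?C" by (rule finite_graph_component_of[OF H])
  have "2 * card (induced_edges H ?C) = (\<Sum>u\<in>?C. vertex_degree (induced_edges H ?C) u)"
    using H fC by (intro sum_vertex_degree[symmetric]) (auto simp: induced_edges_def)
  also have "\<dots> = (\<Sum>u\<in>?C. vertex_degree H u)"
    by (rule sum.cong) (simp_all add: vertex_degree_induced_component[OF H(2)])
  also have "\<dots> = (\<Sum>u\<in>?C - {p, q, r}. vertex_degree H u) + (\<Sum>u\<in>{p, q, r}. vertex_degree H u)"
    by (rule sum.subset_diff[OF pqr(1) fC])
  also have "\<dots> \<le> (\<Sum>u\<in>?C - {p, q, r}. 2) + (\<Sum>u\<in>{p, q, r}. 1)"
    by (intro add_mono sum_mono deg leaf)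
  also have "\<dots> = 2 * (card ?C - 3) + 3"
    using pqr by (simp add: card_Diff_subset)
  finally have "2 * card (induced_edges H ?C) \<le> 2 * (card ?C - 3) + 3" .
  moreover have "card ?C \<ge> 3" using pqr card_mono[OF fC pqr(1)] by simp
  moreover have "card ?C \<le> card (induced_edges H ?C) + 1"
    using card_component_le[OF H] by (simp add: induced_edges_def)
  ultimately show False by linarith
qed

section \<open>Kempe chains and colour swaps\<close>

definition kempe_component :: "'a set set \<Rightarrow> ('a set \<Rightarrow> nat) \<Rightarrow> nat \<Rightarrow> nat \<Rightarrow> 'a \<Rightarrow> 'a set" where
  "kempe_component F c a b v = graph_component_of {e \<in> F. c e = a \<or> c e = b} v"

lemma kempe_component_sym:
  "u \<in> kempe_component F c a b v \<Longrightarrow> v \<in> kempe_component F c a b u"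
  unfolding kempe_component_def by (rule graph_component_of_sym)

lemma kempe_component_trans:
  "u \<in> kempe_component F c a b v \<Longrightarrow> v \<in> kempe_component F c a b w \<Longrightarrow>
    u \<in> kempe_component F c a b w"
  unfolding kempe_component_def by (simp add: graph_component_of_eq)

text \<open>An edge of a third colour may meet the component without lying in it, but
  \<open>transpose a b\<close> fixes that colour, so it is enough to test whether \<open>e\<close>
  meets the component.\<close>

definition kempe_swap ::
    "'a set set \<Rightarrow> ('a set \<Rightarrow> nat) \<Rightarrow> nat \<Rightarrow> nat \<Rightarrow> 'a \<Rightarrow> 'a set \<Rightarrow> nat" where
  "kempe_swap F c a b v e =
    (if e \<inter> kempe_component F c a b v = {} then c e else transpose a b (c e))"

text \<open>An edge coloured \<open>a\<close> or \<open>b\<close> lies inside the component or is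
  disjoint from it, so the test can be read off at any single end \<open>u\<close>. For other
  colours both branches agree.\<close>

lemma kempe_swap_at:
  assumes "\<And>e. e \<in> F \<Longrightarrow> card e = 2" "e \<in> F" "u \<in> e"
  shows "kempe_swap F c a b v e =
    (if u \<in> kempe_component F c a b v then transpose a b (c e) else c e)"
proof (cases "c e = a \<or> c e = b")
  case True
  then have "e \<subseteq> kempe_component F c a b v" if "w \<in> e" "w \<in> kempe_component F c a b v" for w
    using assms that graph_component_of_edge[of e "{e \<in> F. c e = a \<or> c e = b}" w v]
    by (auto simp: kempe_component_def)
  then show ?thesis using assms(3) by (auto simp: kempe_swap_def)
next
  case False
  then show ?thesis by (simp add: kempe_swap_def transpose_def)
qed

text \<open>At a common vertex of two edges the same injective map acts on both colours.\<close>

lemma proper_kempe_swap: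
  assumes "\<And>e. e \<in> F \<Longrightarrow> card e = 2" "proper_edge_colouring F c"
  shows "proper_edge_colouring F (kempe_swap F c a b v)"
  unfolding proper_edge_colouring_def
proof (intro ballI impI)
  fix e f assume ef: "e \<in> F" "f \<in> F" "e \<noteq> f" "e \<inter> f \<noteq> {}"
  then obtain u where u: "u \<in> e" "u \<in> f" by blast
  have "c e \<noteq> c f" using assms(2) ef by (simp add: proper_edge_colouring_def)
  then show "kempe_swap F c a b v e \<noteq> kempe_swap F c a b v f"
    using kempe_swap_at[OF assms(1) ef(1) u(1)] kempe_swap_at[OF assms(1) ef(2) u(2)]
    by (simp add: inj_eq[OF inj_transpose])
qed

lemma missing_kempe_swap:
  assumes "\<And>e. e \<in> F \<Longrightarrow> card e = 2"
  shows "missing F (kempe_swap F c a b v) g u \<longleftrightarrow>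
    missing F c (if u \<in> kempe_component F c a b v then transpose a b g else g) u"
proof -
  have "kempe_swap F c a b v e = g \<longleftrightarrow>
      c e = (if u \<in> kempe_component F c a b v then transpose a b g else g)" if "e \<in> F" "u \<in> e" for e
    using kempe_swap_at[OF assms that, of c a b v]
    by (simp only: split: if_split) (metis transpose_involutory)
  then show ?thesis unfolding missing_def by blast
qed

lemma kempe_swap_less:
  assumes "c ` F \<subseteq> {..<n}" "a < n" "b < n"
  shows "kempe_swap F c a b v ` F \<subseteq> {..<n}"
  using assms by (auto simp: kempe_swap_def transpose_def)

lemma vertex_degree_le_colours:
  assumes "proper_edge_colouring F c" "\<And>e. e \<in> F \<Longrightarrow> v \<in> e \<Longrightarrow> c e \<in> S" "finite S"
  shows "vertex_degree F v \<le> card S"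
proof -
  have "inj_on c {e \<in> F. v \<in> e}"
    using proper_edge_colouringD[OF assms(1), of _ _ v] by (intro inj_onI) simp
  moreover have "c ` {e \<in> F. v \<in> e} \<subseteq> S" using assms(2) by blast
  ultimately show ?thesis using card_inj_on_le assms(3) by (metis vertex_degree_def)
qed

lemma kempe_degrees:
  assumes "proper_edge_colouring F c"
  shows "vertex_degree {e \<in> F. c e = a \<or> c e = b} v \<le> 2"
    and "missing F c a v \<or> missing F c b v \<Longrightarrow>
      vertex_degree {e \<in> F. c e = a \<or> c e = b} v \<le> 1"
proof -
  let ?H = "{e \<in> F. c e = a \<or> c e = b}"
  have proper: "proper_edge_colouring ?H c" using assms by (simp add: proper_edge_colouring_def)
  have "vertex_degree ?H v \<le> card {a, b}"
    by (rule vertex_degree_le_colours[OF proper]) auto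
  also have "\<dots> \<le> 2" by (simp add: card_insert_if)
  finally show "vertex_degree ?H v \<le> 2" .
  assume "missing F c a v \<or> missing F c b v"
  then show "vertex_degree ?H v \<le> 1"
  proof
    assume "missing F c a v"
    then have "vertex_degree ?H v \<le> card {b}"
      by (intro vertex_degree_le_colours[OF proper]) (auto simp: missing_def)
    then show ?thesis by simp
  next
    assume "missing F c b v"
    then have "vertex_degree ?H v \<le> card {a}"
      by (intro vertex_degree_le_colours[OF proper]) (auto simp: missing_def)
    then show ?thesis by simp
  qed
qed

section \<open>Vizing fans\<close>

definition fan :: "'a set set \<Rightarrow> ('a set \<Rightarrow> nat) \<Rightarrow> 'a \<Rightarrow> 'a list \<Rightarrow> bool" where
  "fan F c x ys \<longleftrightarrow> distinct ys \<and> x \<notin> set ys \<and> (\<forall>z\<in>set (tl ys). {x, z} \<in> F) \<and>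
    successively (\<lambda>y z. missing F c (c {x, z}) y) ys"

text \<open>The colour of \<open>{x, z}\<close> moves to \<open>{x, y}\<close>, which makes
  \<open>{x, z}\<close> the uncoloured edge of a shorter fan; the last edge finally receives
  \<open>a\<close>. So the induction varies \<open>F\<close> and \<open>c\<close>, and
  \<open>fan\<close> asks only the tail to be joined to \<open>x\<close> in \<open>F\<close>,
  because the edge to the head has no colour yet.\<close>

lemma fan_shift:
  assumes "fan F c x (y # ys)" "proper_edge_colouring F c" "c ` F \<subseteq> {..<n}" "{x, y} \<notin> F"
    "missing F c a x" "missing F c a (last (y # ys))" "a < n"
  shows "\<exists>c'. proper_edge_colouring (insert {x, y} F) c' \<and> c' ` insert {x, y} F \<subseteq> {..<n}"
  using assms
proof (induction ys arbitrary: y F c)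
  case Nil
  then have "proper_edge_colouring (insert {x, y} F) (c({x, y} := a))"
    by (auto simp: proper_edge_colouring_def missing_def)
  moreover have "c({x, y} := a) ` insert {x, y} F \<subseteq> {..<n}" using Nil by auto
  ultimately show ?case by blast
next
  case (Cons z zs)
  let ?F = "insert {x, y} (F - {{x, z}})" and ?c = "c({x, y} := c {x, z})"
  have xz: "{x, z} \<in> F" "x \<noteq> y" "x \<noteq> z" "y \<noteq> z" "missing F c (c {x, z}) y" "distinct (z # zs)"
    "x \<notin> set (z # zs)" "y \<notin> set (z # zs)" "\<forall>w\<in>set zs. {x, w} \<in> F"
    "successively (\<lambda>y z. missing F c (c {x, z}) y) (z # zs)"
    using Cons.prems(1) by (auto simp: fan_def)
  \<comment> \<open>Apart from \<open>x\<close> and \<open>y\<close> no vertex gains a coloured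
    edge, so its missing colours stay missing.\<close>
  have miss: "missing ?F ?c g u" if "missing F c g u" "u \<notin> {x, y}" for g u
    using that by (auto simp: missing_def)
  have succ: "successively (\<lambda>y z. missing ?F ?c (?c {x, z}) y) (z # zs)"
  proof (rule successively_mono[OF xz(10)])
    fix u w assume "u \<in> set (z # zs)" "w \<in> set (z # zs)" "missing F c (c {x, w}) u"
    moreover from this have "{x, w} \<noteq> {x, y}" using xz(8) by (auto simp: doubleton_eq_iff)
    ultimately show "missing ?F ?c (?c {x, w}) u" using miss xz(7,8) by auto
  qed
  have "fan ?F ?c x (z # zs)"
    using xz succ by (auto simp: fan_def doubleton_eq_iff)
  moreover have "proper_edge_colouring ?F ?c"
    unfolding proper_edge_colouring_def
  proof (intro ballI impI)
    \<comment> \<open>The fan condition says that the moved colour is free at \<open>y\<close>; at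
      \<open>x\<close> it occurred only on \<open>{x, z}\<close>, which has left
      \<open>?F\<close>.\<close>
    have new: "c {x, z} \<noteq> c f" if "f \<in> F" "f \<noteq> {x, z}" "{x, y} \<inter> f \<noteq> {}" for f
    proof (cases "y \<in> f")
      case True
      then show ?thesis using xz(5) that by (auto simp: missing_def)
    next
      case False
      then show ?thesis
        using that xz(1) proper_edge_colouringD[OF Cons.prems(2) xz(1), of f x] by auto
    qed
    fix e f assume ef: "e \<in> ?F" "f \<in> ?F" "e \<noteq> f" "e \<inter> f \<noteq> {}"
    consider "e = {x, y}" "f \<noteq> {x, y}" | "f = {x, y}" "e \<noteq> {x, y}" | "e \<noteq> {x, y}" "f \<noteq> {x, y}"
      using ef(3) by blast
    then show "?c e \<noteq> ?c f"
    proof cases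
      case 1
      then show ?thesis using new[of f] ef by simp
    next
      case 2
      then show ?thesis using new[of e] ef by (simp add: Int_commute)
    next
      case 3
      then have "c e \<noteq> c f" using ef Cons.prems(2) by (simp add: proper_edge_colouring_def)
      then show ?thesis using 3 by simp
    qed
  qed
  moreover have "?c ` ?F \<subseteq> {..<n}" using Cons.prems(3) xz(1) by auto
  moreover have "{x, z} \<notin> ?F" using xz by (auto simp: doubleton_eq_iff)
  moreover have "missing ?F ?c a x" using Cons.prems(5) xz(1) by (auto simp: missing_def)
  moreover have "missing ?F ?c a (last (z # zs))"
  proof (rule miss)
    show "missing F c a (last (z # zs))" using Cons.prems(6) by simp
    have "last (z # zs) \<in> set (z # zs)" by (rule last_in_set) simp
    then show "last (z # zs) \<notin> {x, y}" using xz(7,8) by blast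
  qed
  ultimately have "\<exists>c'. proper_edge_colouring (insert {x, z} ?F) c' \<and> c' ` insert {x, z} ?F \<subseteq> {..<n}"
    using Cons.prems(7) by (intro Cons.IH)
  moreover have "insert {x, z} ?F = insert {x, y} F" using xz(1) by blast
  ultimately show ?case by simp
qed

text \<open>Take a longest fan, a colour \<open>a\<close> missing at \<open>x\<close> and a colour
  \<open>b\<close> missing at its last vertex \<open>l\<close>. If \<open>b\<close> is missing at
  \<open>x\<close> too, shifting finishes. Otherwise the edge of colour \<open>b\<close> at
  \<open>x\<close> leads to a fan vertex \<open>z\<close>, whose predecessor \<open>u\<close> misses
  \<open>b\<close> as well. Swapping \<open>a\<close> and \<open>b\<close> on a chain through
  \<open>u\<close> or \<open>l\<close> that avoids \<open>x\<close> makes \<open>a\<close> missing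
  there as well as at \<open>x\<close>, and the fan ending there can be shifted.\<close>

lemma vizing_extend:
  assumes E: "finite E" "\<And>e. e \<in> E \<Longrightarrow> card e = 2" and deg: "\<And>v. vertex_degree E v < n"
    and e: "e \<in> E" and c: "proper_edge_colouring (E - {e}) c" "c ` (E - {e}) \<subseteq> {..<n}"
  shows "\<exists>c'. proper_edge_colouring E c' \<and> c' ` E \<subseteq> {..<n}"
proof -
  obtain x y where xy: "e = {x, y}" "x \<noteq> y" using E(2)[OF e] by (auto simp: card_2_iff)
  define F where "F = E - {{x, y}}"
  have F: "finite F" "\<And>e. e \<in> F \<Longrightarrow> card e = 2" "{x, y} \<notin> F" and E_eq: "insert {x, y} F = E"
    and cF: "proper_edge_colouring F c" "c ` F \<subseteq> {..<n}"
    using E e xy c by (auto simp: F_def)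
  have degF: "vertex_degree F v < n" for v
    using deg[of v] vertex_degree_split[of E F v] E(1) by (simp add: F_def)
  have "fan F c x [y]" using xy by (simp add: fan_def)
  moreover have "\<forall>ys. fan F c x (y # ys) \<longrightarrow> length ys < Suc (card (\<Union>F))"
  proof (intro allI impI)
    fix ys assume "fan F c x (y # ys)"
    then have "set ys \<subseteq> \<Union>F" "distinct ys" by (auto simp: fan_def)
    then show "length ys < Suc (card (\<Union>F))"
      using card_mono[OF finite_Union_edges[OF F(1,2)], of "set ys"]
      by (simp add: distinct_card less_Suc_eq_le)
  qed
  ultimately have "\<exists>ys. fan F c x (y # ys) \<and> (\<forall>zs. fan F c x (y # zs) \<longrightarrow> length zs \<le> length ys)"
    by (rule ex_has_greatest_nat)
  then obtain ys where fan: "fan F c x (y # ys)"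
    and max: "\<And>zs. fan F c x (y # zs) \<Longrightarrow> length zs \<le> length ys" by blast
  define l where "l = last (y # ys)"
  have l: "l \<in> set (y # ys)" unfolding l_def by (rule last_in_set) simp
  obtain a where a: "a < n" "missing F c a x" using exists_missing_colour[OF F(1) degF] by blast
  obtain b where b: "b < n" "missing F c b l" using exists_missing_colour[OF F(1) degF] by blast
  show ?thesis
  proof (cases "missing F c b x")
    case True
    then show ?thesis using fan_shift[OF fan cF F(3)] b E_eq by (auto simp: l_def)
  next
    case False
    then obtain f where f: "f \<in> F" "x \<in> f" "c f = b" by (auto simp: missing_def)
    then obtain z where z: "f = {x, z}" "z \<noteq> x" using F(2)[OF f(1)] by (auto simp: card_2_iff)
    have "a \<noteq> b" using a f by (auto simp: missing_def)
    \<comment> \<open>Otherwise \<open>z\<close> could be appended to the longest fan, since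
      \<open>{x, z}\<close> has colour \<open>b\<close> and \<open>b\<close> is missing at
      \<open>l\<close>.\<close>
    have "z \<in> set (y # ys)"
    proof (rule ccontr)
      assume new: "z \<notin> set (y # ys)"
      have "successively (\<lambda>y z. missing F c (c {x, z}) y) ((y # ys) @ [z])"
        unfolding successively_append_iff using fan b f z by (simp add: fan_def l_def)
      then have "fan F c x (y # (ys @ [z]))" using fan new f z by (auto simp: fan_def)
      then show False using max[of "ys @ [z]"] by simp
    qed
    moreover have "z \<noteq> y" using f z F(3) by auto
    ultimately obtain ps qs where ys: "ys = ps @ z # qs" by (auto dest: split_list)
    define u where "u = last (y # ps)"
    have fan_ps: "fan F c x (y # ps)"
      and uz: "missing F c b u" "u \<in> set (y # ps)"
      using fan f z by (auto simp: fan_def ys u_def successively_append_iff successively_Cons)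
    have "l \<in> set (z # qs)" unfolding l_def ys by (simp add: last_in_set)
    have dist: "distinct (y # ps @ z # qs)" "x \<notin> set (y # ps @ z # qs)"
      using fan by (simp_all add: fan_def ys)
    have "l \<noteq> u" "x \<noteq> u" "x \<noteq> l"
      using dist uz(2) \<open>l \<in> set (z # qs)\<close> by auto
    have colour: "c {x, w} \<noteq> a" "w \<noteq> z \<Longrightarrow> c {x, w} \<noteq> b" if "w \<in> set ys" for w
    proof -
      have "{x, w} \<in> F" using fan that by (simp add: fan_def)
      then show "c {x, w} \<noteq> a" using a(2) by (auto simp: missing_def)
      assume "w \<noteq> z"
      then have "{x, w} \<noteq> f" using z by (auto simp: doubleton_eq_iff)
      then show "c {x, w} \<noteq> b"
        using proper_edge_colouringD[OF cF(1) \<open>{x, w} \<in> F\<close> f(1), of x] f by auto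
    qed
    let ?K = "kempe_component F c a b" and ?c = "kempe_swap F c a b"
    have swap: ?thesis if fan': "fan F (?c w) x (y # ts)" and w: "w = last (y # ts)" "missing F c b w"
      and x: "x \<notin> ?K w" for w ts
    proof -
      have "missing F (?c w) a x" using a(2) x by (simp add: missing_kempe_swap[OF F(2)])
      moreover have "missing F (?c w) a w"
        using w by (simp add: missing_kempe_swap[OF F(2)] kempe_component_def graph_component_of_refl)
      ultimately have "\<exists>c'. proper_edge_colouring (insert {x, y} F) c' \<and>
          c' ` insert {x, y} F \<subseteq> {..<n}"
        using fan' F(3) a(1) w(1) proper_kempe_swap[OF F(2) cF(1)]
          kempe_swap_less[OF cF(2) a(1) b(1)]
        by (intro fan_shift[where y = y and ys = ts and a = a]) simp_all
      then show ?thesis by (simp only: E_eq)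
    qed
    \<comment> \<open>A swap avoiding \<open>x\<close> leaves the colours at \<open>x\<close> alone.
      By \<open>colour\<close>, a fan condition can then break only at the step to \<open>z\<close>,
      where the colour is \<open>b\<close>; there the predecessor has to lie outside the swapped
      chain.\<close>
    have keep: "missing F (?c w) (?c w {x, t}) s"
      if "missing F c (c {x, t}) s" "t \<in> set ys" "x \<notin> ?K w" "t = z \<Longrightarrow> s \<notin> ?K w" for s t w
    proof -
      have "{x, t} \<in> F" using fan that by (simp add: fan_def)
      then have "?c w {x, t} = c {x, t}"
        using kempe_swap_at[OF F(2), where e = "{x, t}" and u = x] that(3) by simp
      then show ?thesis
        using that colour[of t] by (cases "t = z") (simp_all add: missing_kempe_swap[OF F(2)])
    qed
    have keep_list: "successively (\<lambda>y z. missing F (?c w) (?c w {x, z}) y) (t # ts)"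
      if "successively (\<lambda>y z. missing F c (c {x, z}) y) (t # ts)" "set ts \<subseteq> set ys - {z}"
        "distinct (t # ts)" "x \<notin> ?K w" for t ts w
      using that by (induction ts arbitrary: t) (auto intro: keep)
    let ?H = "{e \<in> F. c e = a \<or> c e = b}"
    \<comment> \<open>\<open>u\<close> and \<open>l\<close> both miss \<open>b\<close>, so one of them can be recoloured to miss \<open>a\<close> without touching \<open>x\<close>.\<close>
    have "\<not> {x, u, l} \<subseteq> graph_component_of ?H x"
    proof
      assume sub: "{x, u, l} \<subseteq> graph_component_of ?H x"
      have "vertex_degree ?H v \<le> 1" if "v \<in> {x, u, l}" for v
        using that a(2) b(2) uz(1) by (intro kempe_degrees(2)[OF cF(1)]) auto
      moreover have "card {x, u, l} = 3" using \<open>l \<noteq> u\<close> \<open>x \<noteq> u\<close> \<open>x \<noteq> l\<close> by simp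
      ultimately show False
        using no_three_leaves[OF _ _ kempe_degrees(1)[OF cF(1)] sub] F(1,2) by auto
    qed
    then consider "u \<notin> ?K x" | "u \<in> ?K x" "l \<notin> ?K x"
      by (auto simp: kempe_component_def graph_component_of_refl)
    then show ?thesis
    proof cases
      \<comment> \<open>The fan ending at \<open>u\<close> stops before \<open>z\<close>, so none of
        its conditions involves \<open>a\<close> or \<open>b\<close>.\<close>
      case 1
      then have x: "x \<notin> ?K u" using kempe_component_sym[of x F c a b u] by blast
      have "successively (\<lambda>y z. missing F (?c u) (?c u {x, z}) y) (y # ps)"
        using fan_ps dist x by (intro keep_list) (auto simp: fan_def ys)
      then have "fan F (?c u) x (y # ps)" using fan_ps by (simp add: fan_def)
      then show ?thesis by (rule swap[OF _ u_def uz(1) x])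
    next
      \<comment> \<open>Here \<open>u\<close> lies on the chain of \<open>x\<close>, so the swap at
        \<open>l\<close> leaves \<open>u\<close> alone and the step from \<open>u\<close> to
        \<open>z\<close> survives in the full fan.\<close>
      case 2
      then have x: "x \<notin> ?K l" and u: "u \<notin> ?K l"
        using kempe_component_sym[of x F c a b l] kempe_component_sym[of u F c a b l]
          kempe_component_trans[of l F c a b u x] by blast+
      have "successively (\<lambda>y z. missing F (?c l) (?c l {x, z}) y) (y # ys)"
      proof -
        have split: "y # ys = (y # ps) @ (z # qs)" by (simp add: ys)
        have succ: "successively (\<lambda>y z. missing F c (c {x, z}) y) (y # ys)"
          using fan by (simp add: fan_def)
        have "successively (\<lambda>y z. missing F (?c l) (?c l {x, z}) y) (y # ps)"
          using fan_ps dist x by (intro keep_list) (auto simp: fan_def ys)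
        moreover have "successively (\<lambda>y z. missing F (?c l) (?c l {x, z}) y) (z # qs)"
          using succ[unfolded split successively_append_iff] dist x by (intro keep_list) (auto simp: ys)
        moreover have "missing F (?c l) (?c l {x, z}) u"
          using uz(1) f z u x by (intro keep) (auto simp: ys)
        ultimately show ?thesis by (simp only: split successively_append_iff u_def) simp
      qed
      then have "fan F (?c l) x (y # ys)" using fan by (simp add: fan_def)
      then show ?thesis by (rule swap[OF _ l_def b(2) x])
    qed
  qed
qed

theorem vizing:
  assumes "finite E" "\<And>e. e \<in> E \<Longrightarrow> card e = 2" "\<And>v. vertex_degree E v < n"
  shows "\<exists>c. proper_edge_colouring E c \<and> c ` E \<subseteq> {..<n}"
  using assms
proof (induction E rule: finite_induct)
  case empty
  show ?case by (simp add: proper_edge_colouring_def)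
next
  case (insert e F)
  have "vertex_degree F v < n" for v
    using insert.prems(2)[of v] vertex_degree_insert[OF insert.hyps, of v] by simp
  then obtain c where "proper_edge_colouring F c" "c ` F \<subseteq> {..<n}"
    using insert.IH insert.prems(1) by blast
  then show ?case
    using insert.hyps insert.prems by (intro vizing_extend[of _ n e c]) simp_all
qed

section \<open>The defective chromatic index\<close>

definition defect_colourable :: "nat \<Rightarrow> 'a set \<Rightarrow> 'a set set \<Rightarrow> nat \<Rightarrow> bool" where
  "defect_colourable d V E k \<longleftrightarrow>
    (\<exists>c :: 'a set \<Rightarrow> nat. c ` E \<subseteq> {..<k} \<and> defect_edge_colouring d V E c)"

lemma defect_edge_colouring_iff:
  "defect_edge_colouring d V E c \<longleftrightarrow> (\<forall>v\<in>V. \<forall>i. vertex_degree {e \<in> E. c e = i} v \<le> d)"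
proof -
  have "{e \<in> {e \<in> E. c e = i}. v \<in> e} = {e \<in> E. v \<in> e \<and> c e = i}" for i v by blast
  then show ?thesis by (simp add: defect_edge_colouring_def vertex_degree_def)
qed

lemma defect_chromatic_index_le:
  "defect_colourable d V E k \<Longrightarrow> defect_chromatic_index d V E \<le> k"
  unfolding defect_chromatic_index_def defect_colourable_def by (rule Least_le)

lemma defect_colourable_index:
  assumes "simple_graph V E" "d \<ge> 1"
  shows "defect_colourable d V E (defect_chromatic_index d V E)"
  using defect_edge_colouring_exists[OF assms]
  unfolding defect_chromatic_index_def defect_colourable_def by (rule LeastI_ex)

lemma defect_colourable_degree_le:
  assumes "finite E" "defect_colourable d V E k" "v \<in> V"
  shows "vertex_degree E v \<le> k * d"
proof -
  obtain c :: "'a set \<Rightarrow> nat" where c: "c ` E \<subseteq> {..<k}" "\<And>i. vertex_degree {e \<in> E. c e = i} v \<le> d"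
    using assms(2,3) by (auto simp: defect_colourable_def defect_edge_colouring_iff)
  have "vertex_degree E v = (\<Sum>i<k. vertex_degree {e \<in> E. c e = i} v)"
    by (rule sum_vertex_degree_colours[OF assms(1) c(1), symmetric])
  also have "\<dots> \<le> (\<Sum>i<k. d)" by (rule sum_mono) (rule c(2))
  finally show ?thesis by simp
qed

text \<open>Merging \<open>d\<close> colours of a proper edge colouring gives a single colour with defect \<open>d\<close>.\<close>

lemma defect_colourable_vizing:
  assumes E: "finite E" "\<And>e. e \<in> E \<Longrightarrow> card e = 2" and deg: "\<And>v. vertex_degree E v < k * d"
  shows "defect_colourable d V E k"
proof -
  obtain c where c: "proper_edge_colouring E c" "c ` E \<subseteq> {..<k * d}"
    using vizing[OF E deg] by blast
  \<comment> \<open>A strict bound at any vertex whatever excludes \<open>d = 0\<close>.\<close>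
  have "d > 0" using deg[of undefined] by (cases d) simp_all
  let ?c = "\<lambda>e. c e div d"
  have "vertex_degree {e \<in> E. ?c e = i} v \<le> card {i * d..<i * d + d}" for i v
  proof (rule vertex_degree_le_colours)
    show "proper_edge_colouring {e \<in> E. ?c e = i} c"
      using c(1) by (simp add: proper_edge_colouring_def)
    fix e assume "e \<in> {e \<in> E. ?c e = i}"
    then have "c e = i * d + c e mod d" using div_mult_mod_eq[of "c e" d] by simp
    then show "c e \<in> {i * d..<i * d + d}"
      using mod_less_divisor[OF \<open>d > 0\<close>, of "c e"] by simp
  qed simp
  then have "defect_edge_colouring d V E ?c" by (simp add: defect_edge_colouring_iff)
  moreover have "?c ` E \<subseteq> {..<k}"
    using c(2) by (auto intro: less_mult_imp_div_less)
  ultimately show ?thesis unfolding defect_colourable_def by (intro exI[of _ ?c]) simp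
qed

lemma defect_colourable_even:
  assumes "finite E" "\<And>e. e \<in> E \<Longrightarrow> card e = 2" "even d" "\<And>v. vertex_degree E v \<le> k * d"
  shows "defect_colourable d V E k"
proof -
  have "\<exists>c. c ` E \<subseteq> {..<k} \<and> (\<forall>v i. vertex_degree {e \<in> E. c e = i} v \<le> d)"
    by (rule even_defect_colouring[OF assms])
  then obtain c where "c ` E \<subseteq> {..<k}" "\<forall>v i. vertex_degree {e \<in> E. c e = i} v \<le> d"
    by (elim exE conjE)
  then show ?thesis
    unfolding defect_colourable_def defect_edge_colouring_iff by (intro exI[of _ c]) simp
qed

lemma defect_colourable_1:
  assumes "finite E" "\<And>v. vertex_degree E v \<le> d"
  shows "defect_colourable d V E 1"
proof -
  have "{e \<in> E. (0::nat) = i} \<subseteq> E" for i by blast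
  then have "vertex_degree {e \<in> E. (0::nat) = i} v \<le> d" for i v
    using vertex_degree_split[OF assms(1), of "{e \<in> E. (0::nat) = i}" v] assms(2)[of v] by simp
  then show ?thesis
    unfolding defect_colourable_def defect_edge_colouring_iff by (intro exI[of _ "\<lambda>_. 0"]) auto
qed

text \<open>For degrees at most \<open>2 * d\<close> the bound in \<open>split_edges\<close> is
  simply \<open>d\<close>, so its two parts serve as colour classes.\<close>

lemma defect_colourable_2:
  assumes E: "finite E" "\<And>e. e \<in> E \<Longrightarrow> card e = 2" and deg: "\<And>v. vertex_degree E v \<le> 2 * d"
    and reg: "\<And>v. (\<forall>u\<in>graph_component_of E v. vertex_degree E u = 2 * d) \<Longrightarrow>
      even (card (graph_component_of E v))"
  shows "defect_colourable d V E 2"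
proof -
  obtain A where A: "A \<subseteq> E" "\<And>v. vertex_degree A v \<le> max d (vertex_degree E v - d)"
    "\<And>v. vertex_degree (E - A) v \<le> max d (vertex_degree E v - d)"
    using split_edges[OF E, of d] reg by auto
  have "max d (vertex_degree E v - d) = d" for v using deg[of v] by simp
  then have deg_A: "vertex_degree A v \<le> d" "vertex_degree (E - A) v \<le> d" for v
    using A(2,3)[of v] by simp_all
  define c :: "'a set \<Rightarrow> nat" where "c e = (if e \<in> A then 0 else 1)" for e
  have "{e \<in> E. c e = i} = (if i = 0 then A else if i = 1 then E - A else {})" for i
    using A(1) by (auto simp: c_def)
  then have "vertex_degree {e \<in> E. c e = i} v \<le> d" for i v
    using deg_A[of v] by (simp add: vertex_degree_def)
  moreover have "c ` E \<subseteq> {..<2}" by (auto simp: c_def)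
  ultimately show ?thesis unfolding defect_colourable_def defect_edge_colouring_iff by blast
qed

text \<open>Two classes with at most \<open>d\<close> edges each at a vertex of degree
  \<open>2 * d\<close> have exactly \<open>d\<close> each. The handshake lemma for one class makes
  \<open>card ?C * d\<close> even, and \<open>d\<close> is odd.\<close>

lemma even_card_regular_component:
  assumes E: "finite E" "\<And>e. e \<in> E \<Longrightarrow> card e = 2" "\<Union>E \<subseteq> V" and "odd d"
    and col: "defect_colourable d V E 2" and "v \<in> V"
    and reg: "\<forall>u\<in>graph_component_of E v. vertex_degree E u = 2 * d"
  shows "even (card (graph_component_of E v))"
proof -
  let ?C = "graph_component_of E v"
  obtain c :: "'a set \<Rightarrow> nat" where c: "c ` E \<subseteq> {..<2}"
    "\<And>u i. u \<in> V \<Longrightarrow> vertex_degree {e \<in> E. c e = i} u \<le> d"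
    using col by (auto simp: defect_colourable_def defect_edge_colouring_iff)
  have C: "?C \<subseteq> V" using graph_component_of_subset[of E v] E(3) \<open>v \<in> V\<close> by blast
  have "vertex_degree {e \<in> E. c e = 0} u = d" if "u \<in> ?C" for u
  proof -
    have "vertex_degree {e \<in> E. c e = 0} u + vertex_degree {e \<in> E. c e = 1} u = 2 * d"
      using sum_vertex_degree_colours[OF E(1) c(1), of u] reg that by (simp add: numeral_2_eq_2)
    then show ?thesis using c(2)[of u 0] c(2)[of u 1] C that by fastforce
  qed
  then have "(\<Sum>u\<in>?C. vertex_degree {e \<in> E. c e = 0} u) = card ?C * d" by simp
  moreover have "even (\<Sum>u\<in>?C. vertex_degree {e \<in> E. c e = 0} u)"
    by (rule even_sum_component_degree[OF E(1,2)]) auto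
  ultimately show ?thesis using \<open>odd d\<close> by simp
qed

lemma ceiling_div_le_iff:
  fixes \<Delta> d k :: nat
  assumes "d \<ge> 1"
  shows "\<lceil>real \<Delta> / real d\<rceil> \<le> int k \<longleftrightarrow> \<Delta> \<le> k * d"
proof -
  have "\<lceil>real \<Delta> / real d\<rceil> \<le> int k \<longleftrightarrow> real \<Delta> \<le> real k * real d"
    using assms by (simp add: ceiling_le_iff divide_le_eq)
  also have "\<dots> \<longleftrightarrow> real \<Delta> \<le> real (k * d)" by simp
  finally show ?thesis by (simp only: of_nat_le_iff)
qed

theorem theorem11p4p4:
  fixes V :: "'a set" and E :: "'a set set" and d \<Delta> :: nat
  assumes "d \<ge> 1" and "\<Delta> \<ge> 1"
    and "simple_graph V E" and "max_degree V E = \<Delta>"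
  shows "(\<not> d dvd \<Delta> \<or> even d \<or> \<Delta> = d \<longrightarrow>
            int (defect_chromatic_index d V E) = \<lceil>real \<Delta> / real d\<rceil>) \<and>
         (odd d \<and> \<Delta> = 2 * d \<longrightarrow>
            (defect_chromatic_index d V E = 2 \<longleftrightarrow>
               (\<forall>C\<in>graph_components V E. regular_graph (2 * d) C (induced_edges E C) \<longrightarrow> even (card C))) \<and>
            (defect_chromatic_index d V E \<noteq> 2 \<longrightarrow> defect_chromatic_index d V E = 3))"
proof -
  let ?\<chi> = "defect_chromatic_index d V E"
  have V: "finite V" and EV: "\<Union>E \<subseteq> V" and E2: "\<And>e. e \<in> E \<Longrightarrow> card e = 2"
    using assms(3) by (auto simp: simple_graph_def)
  have finE: "finite E" using V EV finite_UnionD finite_subset by blast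
  \<comment> \<open>The colourability lemmas ask for degree bounds at every element of the type,
    hence also outside \<open>V\<close>.\<close>
  have outside: "vertex_degree E v = 0" if "v \<notin> V" for v
  proof -
    have "{e \<in> E. v \<in> e} = {}" using EV that by blast
    then show ?thesis unfolding vertex_degree_def by (simp only: card.empty)
  qed
  have "vertex_degree E v \<le> \<Delta>" if "v \<in> V" for v
    unfolding assms(4)[symmetric] max_degree_def by (rule Max_ge) (use V that in simp_all)
  then have deg: "vertex_degree E v \<le> \<Delta>" for v using outside[of v] by (cases "v \<in> V") simp_all
  have "\<Delta> \<in> insert 0 (vertex_degree E ` V)"
    unfolding assms(4)[symmetric] max_degree_def by (rule Max_in) (use V in simp_all)
  then obtain w where w: "w \<in> V" "vertex_degree E w = \<Delta>" using assms(2) by auto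
  have col: "defect_colourable d V E ?\<chi>" by (rule defect_colourable_index[OF assms(3,1)])
  then have lower: "\<Delta> \<le> ?\<chi> * d" using defect_colourable_degree_le[OF finE _ w(1)] w(2) by metis
  have "int ?\<chi> = \<lceil>real \<Delta> / real d\<rceil>" if cond: "\<not> d dvd \<Delta> \<or> even d \<or> \<Delta> = d"
  proof (rule antisym)
    define k where "k = nat \<lceil>real \<Delta> / real d\<rceil>"
    have k: "int k = \<lceil>real \<Delta> / real d\<rceil>"
    proof -
      have "0 \<le> real \<Delta> / real d" by simp
      then have "0 \<le> \<lceil>real \<Delta> / real d\<rceil>" by linarith
      then show ?thesis by (simp only: k_def int_nat_eq if_True)
    qed
    have "\<Delta> \<le> k * d" using ceiling_div_le_iff[OF assms(1), of \<Delta> k] k by simp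
    then have degk: "vertex_degree E v \<le> k * d" for v using deg[of v] by linarith
    have "defect_colourable d V E k"
    proof (cases "\<not> d dvd \<Delta>")
      case True
      then have "\<Delta> \<noteq> k * d" by auto
      with \<open>\<Delta> \<le> k * d\<close> have "vertex_degree E v < k * d" for v
        using deg[of v] by linarith
      then show ?thesis using defect_colourable_vizing[OF finE E2] by blast
    next
      case False
      show ?thesis
      proof (cases "even d")
        case True
        show ?thesis by (rule defect_colourable_even[OF finE E2 True degk])
      next
        case odd: False
        then have "\<Delta> = d" using cond False by blast
        then have "k = 1" using assms(1) by (simp add: k_def)
        then show ?thesis using defect_colourable_1[OF finE] deg \<open>\<Delta> = d\<close> by blast
      qed
    qed
    then show "int ?\<chi> \<le> \<lceil>real \<Delta> / real d\<rceil>" using defect_chromatic_index_le k by (metis of_nat_le_iff)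
    show "\<lceil>real \<Delta> / real d\<rceil> \<le> int ?\<chi>" using lower ceiling_div_le_iff[OF assms(1)] by blast
  qed
  moreover have "(?\<chi> = 2 \<longleftrightarrow> (\<forall>C\<in>graph_components V E.
        regular_graph (2 * d) C (induced_edges E C) \<longrightarrow> even (card C))) \<and> (?\<chi> \<noteq> 2 \<longrightarrow> ?\<chi> = 3)"
    if "odd d" "\<Delta> = 2 * d"
  proof -
    have ge2: "?\<chi> \<ge> 2" using lower that assms(1) by simp
    \<comment> \<open>Since \<open>2 * d < 3 * d\<close>, Vizing's theorem with \<open>3 * d\<close>
      colours, merged in groups of \<open>d\<close>, gives three classes.\<close>
    have le3: "?\<chi> \<le> 3"
    proof (intro defect_chromatic_index_le defect_colourable_vizing[OF finE E2])
      show "vertex_degree E v < 3 * d" for v using deg[of v] that assms(1) by linarith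
    qed
    have reg_iff: "regular_graph (2 * d) (graph_component_of E v)
        (induced_edges E (graph_component_of E v)) \<longleftrightarrow>
        (\<forall>u\<in>graph_component_of E v. vertex_degree E u = 2 * d)" for v
      using vertex_degree_induced_component[OF E2 order_refl] by (simp add: regular_graph_def)
    have even_comp: "even (card C)" if C: "?\<chi> = 2" "C \<in> graph_components V E"
      "regular_graph (2 * d) C (induced_edges E C)" for C
    proof -
      obtain v where v: "v \<in> V" "C = graph_component_of E v"
        using C(2) by (auto simp: graph_components_def)
      then show ?thesis
        using even_card_regular_component[OF finE E2 EV \<open>odd d\<close> _ v(1)] col C reg_iff by simp
    qed
    have le2: "?\<chi> \<le> 2" if all: "\<forall>C\<in>graph_components V E.
      regular_graph (2 * d) C (induced_edges E C) \<longrightarrow> even (card C)"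
    proof (intro defect_chromatic_index_le defect_colourable_2[OF finE E2])
      show "vertex_degree E v \<le> 2 * d" for v using deg[of v] \<open>\<Delta> = 2 * d\<close> by simp
      fix v assume reg: "\<forall>u\<in>graph_component_of E v. vertex_degree E u = 2 * d"
      \<comment> \<open>An element outside \<open>V\<close> lies in its own component and has degree
        0, which differs from \<open>2 * d\<close>.\<close>
      have "v \<in> V"
      proof (rule ccontr)
        assume "v \<notin> V"
        then show False using outside reg graph_component_of_refl[of v E] assms(1) by auto
      qed
      then show "even (card (graph_component_of E v))"
        using all reg reg_iff by (auto simp: graph_components_def)
    qed
    show ?thesis
    proof (intro conjI iffI impI ballI)
      show "?\<chi> = 2" if "\<forall>C\<in>graph_components V E.
          regular_graph (2 * d) C (induced_edges E C) \<longrightarrow> even (card C)"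
        using le2[OF that] ge2 by simp
      show "?\<chi> = 3" if "?\<chi> \<noteq> 2" using that ge2 le3 by simp
    qed (rule even_comp)
  qed
  ultimately show ?thesis by blast
qed

end
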